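(* Let $N\ge1$ and $1\le p_0<\infty$. For a real-valued function $V\in L^{p_0}_U(\mathbb{R}^N)$ and $M>0$ define $V_M(x)=M$ if $V(x)>M$, $V_M(x)=V(x)$ if $-M\le V(x)\le M$, and $V_M(x)=-M$ if $V(x)<-M$. (i) A function $V\in L^{p_0}_U(\mathbb{R}^N)$ can be approximated in $L^{p_0}_U(\mathbb{R}^N)$ by bounded functions if and only if $V_M\to V$ in $L^{p_0}_U(\mathbb{R}^N)$ as $M\to\infty$. (ii) If $V\in\dot L^{p_0}_U(\mathbb{R}^N)$ then $V$ can be approximated in $L^{p_0}_U(\mathbb{R}^N)$ by bounded functions. (iii) Let $V\in L^{p_0}_U(\mathbb{R}^N)$ and assume that there exists $M_0>0$ such that $$\lim_{|x|\to\infty}\int_{B(x,1)}|V(y)-V_{M_0}(y)|^{p_0}\,dy=0.$$ Then $V_M\to V$ in $L^{p_0}_U(\mathbb{R}^N)$ as $M\to\infty$. (iv) The class of functions in $L^{p_0}_U(\mathbb{R}^N)$ that can be approximated in $L^{p_0}_U(\mathbb{R}^N)$ by bounded functions is a closed proper subspace of $L^{p_0}_U(\mathbb{R}^N)$.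
   Context: For $1\le p_0<\infty$, $L^{p_0}_U(\mathbb{R}^N)$ is the space of $V\in L^{p_0}_{loc}(\mathbb{R}^N)$ with $\|V\|_{L^{p_0}_U(\mathbb{R}^N)}=\sup_{x_0\in\mathbb{R}^N}\|V\|_{L^{p_0}(B(x_0,1))}<\infty$. "$V$ can be approximated in $L^{p_0}_U(\mathbb{R}^N)$ by bounded functions" means that there is a sequence $W_n\in L^\infty(\mathbb{R}^N)$ with $\|W_n-V\|_{L^{p_0}_U(\mathbb{R}^N)}\to0$. $\dot L^{p_0}_U(\mathbb{R}^N)$ is the subspace of those $V\in L^{p_0}_U(\mathbb{R}^N)$ for which $\|\tau_yV-V\|_{L^{p_0}_U(\mathbb{R}^N)}\to0$ as $|y|\to0$, where $\tau_yV(x)=V(x-y)$. *)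

theory Defs
  imports "HOL-Analysis.Analysis" "HOL-Library.Function_Algebras"
begin

text \<open>
  Functions are not identified up to null sets: the spaces below consist of Lebesgue measurable
  representatives, and \<open>LU_norm\<close> is a seminorm that does not distinguish functions equal
  almost everywhere.
\<close>

definition Lp_norm_on :: "real \<Rightarrow> 'a::euclidean_space set \<Rightarrow> ('a \<Rightarrow> real) \<Rightarrow> real" where
  "Lp_norm_on p S V = (LINT y:S|lebesgue. \<bar>V y\<bar> powr p) powr (1 / p)"

definition Lp_loc :: "real \<Rightarrow> ('a::euclidean_space \<Rightarrow> real) set" where
  "Lp_loc p = {V. V \<in> borel_measurable lebesgue \<and>
     (\<forall>K. compact K \<longrightarrow> set_integrable lebesgue K (\<lambda>y. \<bar>V y\<bar> powr p))}"

text \<open>The real-valued supremum is meaningful only when the family of local norms is bounded above;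
  this is the finiteness condition in \<open>LU\<close>.\<close>

definition LU_norm :: "real \<Rightarrow> ('a::euclidean_space \<Rightarrow> real) \<Rightarrow> real" where
  "LU_norm p V = (SUP x0. Lp_norm_on p (ball x0 1) V)"

definition LU :: "real \<Rightarrow> ('a::euclidean_space \<Rightarrow> real) set" where
  "LU p = {V \<in> Lp_loc p. bdd_above (range (\<lambda>x0. Lp_norm_on p (ball x0 1) V))}"

definition Linfty :: "('a::euclidean_space \<Rightarrow> real) set" where
  "Linfty = {W. W \<in> borel_measurable lebesgue \<and> (\<exists>C. AE x in lebesgue. \<bar>W x\<bar> \<le> C)}"

definition bounded_approximable :: "real \<Rightarrow> ('a::euclidean_space \<Rightarrow> real) \<Rightarrow> bool" where
  "bounded_approximable p V \<longleftrightarrow>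
     (\<exists>W :: nat \<Rightarrow> 'a \<Rightarrow> real. (\<forall>n. W n \<in> Linfty) \<and>
        (\<lambda>n. LU_norm p (\<lambda>x. W n x - V x)) \<longlonglongrightarrow> 0)"

definition translate :: "'a::euclidean_space \<Rightarrow> ('a \<Rightarrow> real) \<Rightarrow> 'a \<Rightarrow> real" where
  "translate y V x = V (x - y)"

definition LU_dot :: "real \<Rightarrow> ('a::euclidean_space \<Rightarrow> real) set" where
  "LU_dot p = {V \<in> LU p. ((\<lambda>y. LU_norm p (\<lambda>x. translate y V x - V x)) \<longlongrightarrow> 0) (at 0)}"

definition truncate :: "real \<Rightarrow> ('a \<Rightarrow> real) \<Rightarrow> 'a \<Rightarrow> real" where
  "truncate M V x = (if V x > M then M else if V x < - M then - M else V x)"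

text \<open>The topology that the seminorm \<open>LU_norm p\<close> induces on \<open>LU p\<close>.\<close>

definition LU_topology :: "real \<Rightarrow> ('a::euclidean_space \<Rightarrow> real) topology" where
  "LU_topology p = topology (\<lambda>S. S \<subseteq> LU p \<and>
     (\<forall>V\<in>S. \<exists>r>0. \<forall>W\<in>LU p. LU_norm p (\<lambda>x. W x - V x) < r \<longrightarrow> W \<in> S))"

lemma openin_LU_topology:
  "openin (LU_topology p) S \<longleftrightarrow> S \<subseteq> LU p \<and>
     (\<forall>V\<in>S. \<exists>r>0. \<forall>W\<in>LU p. LU_norm p (\<lambda>x. W x - V x) < r \<longrightarrow> W \<in> S)"
proof -
  define P where "P S \<longleftrightarrow> S \<subseteq> LU p \<and>
     (\<forall>V\<in>S. \<exists>r>0. \<forall>W\<in>LU p. LU_norm p (\<lambda>x. W x - V x) < r \<longrightarrow> W \<in> S)"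
    for S :: "('a \<Rightarrow> real) set"
  have inter: "P (S \<inter> T)" if S: "P S" and T: "P T" for S T
    unfolding P_def
  proof (intro conjI ballI)
    show "S \<inter> T \<subseteq> LU p" using S unfolding P_def by blast
    fix V assume V: "V \<in> S \<inter> T"
    obtain r where r: "r > 0" "\<forall>W\<in>LU p. LU_norm p (\<lambda>x. W x - V x) < r \<longrightarrow> W \<in> S"
      using S V unfolding P_def by blast
    obtain s where s: "s > 0" "\<forall>W\<in>LU p. LU_norm p (\<lambda>x. W x - V x) < s \<longrightarrow> W \<in> T"
      using T V unfolding P_def by blast
    show "\<exists>r>0. \<forall>W\<in>LU p. LU_norm p (\<lambda>x. W x - V x) < r \<longrightarrow> W \<in> S \<inter> T"
      by (rule exI[of _ "min r s"]) (use r s in simp)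
  qed
  have union: "P (\<Union>\<K>)" if K: "\<forall>K\<in>\<K>. P K" for \<K>
    unfolding P_def
  proof (intro conjI ballI)
    show "\<Union>\<K> \<subseteq> LU p" using K unfolding P_def by blast
    fix V assume "V \<in> \<Union>\<K>"
    then obtain K where VK: "K \<in> \<K>" "V \<in> K" by blast
    then obtain r where "r > 0" "\<forall>W\<in>LU p. LU_norm p (\<lambda>x. W x - V x) < r \<longrightarrow> W \<in> K"
      using K unfolding P_def by meson
    then show "\<exists>r>0. \<forall>W\<in>LU p. LU_norm p (\<lambda>x. W x - V x) < r \<longrightarrow> W \<in> \<Union>\<K>"
      using VK(1) by (meson UnionI)
  qed
  have "istopology P"
    unfolding istopology_def using inter union by blast
  moreover have "LU_topology p = topology P"
    unfolding LU_topology_def P_def ..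
  ultimately have "openin (LU_topology p) S \<longleftrightarrow> P S"
    by (simp add: topology_inverse')
  then show ?thesis
    unfolding P_def .
qed

lemma topspace_LU_topology: "topspace (LU_topology p) = LU p"
proof (rule subset_antisym)
  show "topspace (LU_topology p) \<subseteq> LU p"
    using openin_topspace[of "LU_topology p"] unfolding openin_LU_topology by (rule conjunct1)
  have "openin (LU_topology p) (LU p)"
    unfolding openin_LU_topology using zero_less_one by blast
  then show "LU p \<subseteq> topspace (LU_topology p)"
    by (rule openin_subset)
qed

text \<open>Linear subspaces of the space of all functions, with pointwise operations.\<close>

abbreviation fun_subspace :: "('a \<Rightarrow> real) set \<Rightarrow> bool" where
  "fun_subspace \<equiv> module.subspace (\<lambda>(c::real) (f :: 'a \<Rightarrow> real) x. c * f x)"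

lemma fun_subspace_iff:
  "fun_subspace S \<longleftrightarrow> (\<lambda>x. 0) \<in> S \<and> (\<forall>f\<in>S. \<forall>g\<in>S. (\<lambda>x. f x + g x) \<in> S) \<and>
     (\<forall>c. \<forall>f\<in>S. (\<lambda>x. c * f x) \<in> S)"
proof -
  have "module (\<lambda>(c::real) (f :: 'a \<Rightarrow> real) x. c * f x)"
    by unfold_locales (auto simp: fun_eq_iff algebra_simps)
  from module.subspace_def[OF this, of S] show ?thesis
    by (simp add: zero_fun_def plus_fun_def)
qed

end

theory Submission
  imports Defs
begin

text \<open>
  Everything is expressed through the local masses \<open>\<integral>\<^sup>+y\<in>ball x 1. \<bar>V y\<bar>\<^sup>p\<close>, bounded uniformly in \<open>x\<close>;
  this makes Minkowski's inequality dispensable. Truncation is the best approximation among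
  functions with values in \<open>[-M, M]\<close>, which gives (i). For (ii), \<open>V\<close> is bounded by \<open>M\<close> on at least
  half of every ball \<open>ball x d\<close> once \<open>M\<close> is large, so the truncation error at \<open>x\<close> is at most
  twice the mean of \<open>\<bar>V (x + y) - V x\<bar>\<^sup>p\<close> over \<open>\<bar>y\<bar> < d\<close>; integrating over \<open>x\<close> first, this mean is small
  by continuity of translations. For (iii), the tail condition handles large \<open>\<bar>x\<bar>\<close> and dominated
  convergence on one large ball the rest. For (iv), a sum of widely spaced spikes of growing height
  and equal mass is not approximable.
\<close>

section \<open>Local masses and their link to the seminorm\<close>

text \<open>Taking values in \<open>ennreal\<close> and omitting the p-th root makes comparison,
  scaling and addition available without integrability side conditions.\<close>

definition local_mass :: "real \<Rightarrow> ('a::euclidean_space \<Rightarrow> real) \<Rightarrow> 'a \<Rightarrow> ennreal" where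
  "local_mass p V x = (\<integral>\<^sup>+y\<in>ball x 1. ennreal (\<bar>V y\<bar> powr p) \<partial>lebesgue)"

lemma restricted_powr_measurable:
  fixes V :: "'a \<Rightarrow> real"
  assumes [measurable]: "V \<in> borel_measurable M" "A \<in> sets M"
  shows "(\<lambda>y. ennreal (\<bar>V y\<bar> powr p) * indicator A y) \<in> borel_measurable M"
  by measurable

lemma LU_measurable: "V \<in> LU p \<Longrightarrow> V \<in> borel_measurable lebesgue"
  by (simp add: LU_def Lp_loc_def)

lemma Linfty_measurable: "W \<in> Linfty \<Longrightarrow> W \<in> borel_measurable lebesgue"
  by (simp add: Linfty_def)

text \<open>Integrability excludes the default value 0 of the Bochner integral, so both integrals of
  this nonnegative function agree.\<close>

lemma local_mass_eq_set_integral: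
  assumes int: "set_integrable lebesgue (ball x 1) (\<lambda>y. \<bar>V y\<bar> powr p)"
  shows "local_mass p V x = ennreal (LINT y:ball x 1|lebesgue. \<bar>V y\<bar> powr p)"
proof -
  have "ennreal (LINT y:ball x 1|lebesgue. \<bar>V y\<bar> powr p) =
      (\<integral>\<^sup>+y. ennreal (indicator (ball x 1) y *\<^sub>R \<bar>V y\<bar> powr p) \<partial>lebesgue)"
    unfolding set_lebesgue_integral_def
    by (rule nn_integral_eq_integral[symmetric]) (use int in \<open>auto simp: set_integrable_def\<close>)
  also have "\<dots> = local_mass p V x"
    unfolding local_mass_def by (rule nn_integral_cong) (auto simp: indicator_def)
  finally show ?thesis ..
qed

lemma local_mass_eq_Lp_norm_on:
  assumes "p > 0" and "set_integrable lebesgue (ball x 1) (\<lambda>y. \<bar>V y\<bar> powr p)"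
  shows "local_mass p V x = ennreal (Lp_norm_on p (ball x 1) V powr p)"
proof -
  have "0 \<le> (LINT y:ball x 1|lebesgue. \<bar>V y\<bar> powr p)"
    unfolding set_lebesgue_integral_def by (rule integral_nonneg_AE) auto
  then show ?thesis
    using assms by (simp add: Lp_norm_on_def powr_powr local_mass_eq_set_integral)
qed

lemma Lp_loc_set_integrable_ball:
  assumes "V \<in> Lp_loc p"
  shows "set_integrable lebesgue (ball x 1) (\<lambda>y. \<bar>V y\<bar> powr p)"
proof (rule set_integrable_subset)
  show "set_integrable lebesgue (cball x 1) (\<lambda>y. \<bar>V y\<bar> powr p)"
    using assms by (auto simp: Lp_loc_def)
qed auto

lemma Lp_norm_on_nonneg [simp]: "0 \<le> Lp_norm_on p S V"
  by (simp add: Lp_norm_on_def)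

lemma LU_norm_nonneg:
  assumes "V \<in> LU p" shows "0 \<le> LU_norm p V"
  unfolding LU_norm_def
  \<comment> \<open>Any centre would do, hence \<open>undefined\<close>; boundedness of the family
    is what makes the real supremum an upper bound.\<close>
  using assms by (intro cSUP_upper2[of _ _ undefined]) (auto simp: LU_def)

lemma local_mass_le_LU_norm:
  assumes "p > 0" "V \<in> LU p"
  shows "local_mass p V x \<le> ennreal (LU_norm p V powr p)"
proof -
  have "Lp_norm_on p (ball x 1) V \<le> LU_norm p V"
    unfolding LU_norm_def using assms by (intro cSUP_upper) (auto simp: LU_def)
  then show ?thesis
    using assms local_mass_eq_Lp_norm_on[OF _ Lp_loc_set_integrable_ball, of p V x]
    by (simp add: LU_def ennreal_leI powr_mono2)
qed

lemma local_mass_bound_imp_Lp_norm_on: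
  assumes "p > 0" "V \<in> Lp_loc p" "0 \<le> e" "local_mass p V x \<le> ennreal (e powr p)"
  shows "Lp_norm_on p (ball x 1) V \<le> e"
proof -
  have "Lp_norm_on p (ball x 1) V powr p \<le> e powr p"
    using assms local_mass_eq_Lp_norm_on[OF _ Lp_loc_set_integrable_ball, of p V x]
    by (simp add: ennreal_le_iff)
  then show ?thesis
    using assms by (meson Lp_norm_on_nonneg linorder_not_le powr_less_mono2)
qed

lemma LU_norm_le:
  assumes "p > 0" "V \<in> LU p" "0 \<le> e" "\<And>x. local_mass p V x \<le> ennreal (e powr p)"
  shows "LU_norm p V \<le> e"
  unfolding LU_norm_def
  using assms by (intro cSUP_least local_mass_bound_imp_Lp_norm_on) (auto simp: LU_def)

text \<open>Finitely many unit balls cover a compact set, so a uniform bound on the local masses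
  yields local integrability as well as the finite supremum.\<close>

lemma LU_I:
  assumes "p > 0" and V: "V \<in> borel_measurable lebesgue"
    and bound: "\<And>x. local_mass p V x \<le> ennreal K"
  shows "V \<in> LU p"
proof -
  have "set_integrable lebesgue C (\<lambda>y. \<bar>V y\<bar> powr p)" if C: "compact C" for C
  proof -
    obtain X where X: "finite X" "C \<subseteq> (\<Union>x\<in>X. ball x 1)"
      using compactE_image[OF C, of UNIV "\<lambda>x. ball x 1"] by (metis UNIV_I open_ball centre_in_ball zero_less_one UN_I subsetI)
    have "set_integrable lebesgue (\<Union>x\<in>X. ball x 1) (\<lambda>y. \<bar>V y\<bar> powr p)"
    proof (rule set_integrable_UN[OF X(1)])
      fix x
      have "(\<integral>\<^sup>+y. ennreal (norm (indicator (ball x 1) y *\<^sub>R \<bar>V y\<bar> powr p)) \<partial>lebesgue) = local_mass p V x"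
        unfolding local_mass_def by (rule nn_integral_cong) (auto simp: indicator_def)
      also have "\<dots> < \<infinity>"
        using bound[of x] by (simp add: le_less_trans)
      finally show "set_integrable lebesgue (ball x 1) (\<lambda>y. \<bar>V y\<bar> powr p)"
        unfolding set_integrable_def
        by (intro integrableI_bounded borel_measurable_scaleR borel_measurable_indicator
            measurable_abs_powr) (use V in auto)
    qed auto
    then show ?thesis
      by (rule set_integrable_subset) (use X C in \<open>auto intro: lmeasurable_compact fmeasurableD\<close>)
  qed
  then have loc: "V \<in> Lp_loc p" using V by (simp add: Lp_loc_def)
  \<comment> \<open>The sign of \<open>K\<close> is not known; \<open>ennreal\<close> sends negative
    reals to 0, so passing to the absolute value keeps the bound valid.\<close>
  define L where "L = \<bar>K\<bar> powr (1/p)"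
  have "Lp_norm_on p (ball x 1) V \<le> L" for x
  proof (rule local_mass_bound_imp_Lp_norm_on)
    have "local_mass p V x \<le> ennreal \<bar>K\<bar>"
      using bound[of x] by (rule order_trans) (simp add: ennreal_leI)
    then show "local_mass p V x \<le> ennreal (L powr p)"
      using \<open>p > 0\<close> by (simp add: L_def powr_powr)
  qed (use assms loc in \<open>auto simp: L_def\<close>)
  then show ?thesis
    using loc by (auto simp: LU_def intro!: bdd_aboveI)
qed

text \<open>Turns seminorm convergence into uniform smallness of the local masses. The filter is
  kept general because sequences, levels tending to \<open>at_top\<close> and translations tending
  to 0 all occur below.\<close>

lemma LU_norm_tendsto_0_iff:
  assumes "p > 0" and LU: "\<forall>\<^sub>F i in F. f i \<in> LU p"
  shows "((\<lambda>i. LU_norm p (f i)) \<longlongrightarrow> 0) F \<longleftrightarrow>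
    (\<forall>e>0. \<forall>\<^sub>F i in F. \<forall>x. local_mass p (f i) x \<le> ennreal e)"
proof
  assume lim: "((\<lambda>i. LU_norm p (f i)) \<longlongrightarrow> 0) F"
  show "\<forall>e>0. \<forall>\<^sub>F i in F. \<forall>x. local_mass p (f i) x \<le> ennreal e"
  proof (intro allI impI)
    fix e :: real assume "e > 0"
    then have "\<forall>\<^sub>F i in F. LU_norm p (f i) < e powr (1/p)"
      using lim by (intro order_tendstoD(2)) auto
    with LU show "\<forall>\<^sub>F i in F. \<forall>x. local_mass p (f i) x \<le> ennreal e"
    proof eventually_elim
      case (elim i)
      have "LU_norm p (f i) powr p \<le> (e powr (1/p)) powr p"
        using elim \<open>p > 0\<close> LU_norm_nonneg by (intro powr_mono2) auto
      then have "LU_norm p (f i) powr p \<le> e"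
        using \<open>e > 0\<close> \<open>p > 0\<close> by (simp add: powr_powr)
      then show ?case
        using local_mass_le_LU_norm[OF \<open>p > 0\<close> elim(1)] by (meson ennreal_leI order_trans)
    qed
  qed
next
  assume small: "\<forall>e>0. \<forall>\<^sub>F i in F. \<forall>x. local_mass p (f i) x \<le> ennreal e"
  show "((\<lambda>i. LU_norm p (f i)) \<longlongrightarrow> 0) F"
  proof (rule tendstoI)
    fix e :: real assume "e > 0"
    \<comment> \<open>A supremum of quantities below a bound is only \<open>\<le>\<close> that
      bound, so half of \<open>e\<close> secures the strict inequality.\<close>
    then have "\<forall>\<^sub>F i in F. \<forall>x. local_mass p (f i) x \<le> ennreal ((e/2) powr p)"
      using small by simp
    with LU show "\<forall>\<^sub>F i in F. dist (LU_norm p (f i)) 0 < e"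
    proof eventually_elim
      case (elim i)
      have "LU_norm p (f i) \<le> e / 2"
        by (rule LU_norm_le) (use elim \<open>p > 0\<close> \<open>e > 0\<close> in auto)
      then show ?case using LU_norm_nonneg[OF elim(1)] \<open>e > 0\<close> by simp
    qed
  qed
qed

section \<open>Comparison, quasi-triangle inequality and linear operations on
  \<open>LU\<close>\<close>

lemma local_mass_mono:
  assumes "p > 0" "AE y in lebesgue. \<bar>V y\<bar> \<le> \<bar>W y\<bar>"
  shows "local_mass p V x \<le> local_mass p W x"
  unfolding local_mass_def
  by (rule nn_integral_mono_AE, rule eventually_mono[OF assms(2)])
     (use \<open>p > 0\<close> in \<open>auto intro!: mult_right_mono ennreal_leI powr_mono2\<close>)

lemma local_mass_cmult:
  assumes "V \<in> borel_measurable lebesgue"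
  shows "local_mass p (\<lambda>x. c * V x) x = ennreal (\<bar>c\<bar> powr p) * local_mass p V x"
proof -
  have "local_mass p (\<lambda>x. c * V x) x =
      (\<integral>\<^sup>+y. ennreal (\<bar>c\<bar> powr p) * (ennreal (\<bar>V y\<bar> powr p) * indicator (ball x 1) y) \<partial>lebesgue)"
    by (simp add: local_mass_def abs_mult powr_mult ennreal_mult' mult.assoc)
  also have "\<dots> = ennreal (\<bar>c\<bar> powr p) * local_mass p V x"
    unfolding local_mass_def
    by (intro nn_integral_cmult restricted_powr_measurable) (use assms in auto)
  finally show ?thesis .
qed

text \<open>The sum is at most twice the larger term. The constant \<open>2 powr p\<close> is
  harmless, since only smallness and finiteness of local masses matter.\<close>

lemma powr_add_le:
  fixes a b p :: real
  assumes "p > 0"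
  shows "\<bar>a + b\<bar> powr p \<le> 2 powr p * (\<bar>a\<bar> powr p + \<bar>b\<bar> powr p)"
proof -
  have "\<bar>a + b\<bar> powr p \<le> (2 * max \<bar>a\<bar> \<bar>b\<bar>) powr p"
    using assms by (intro powr_mono2) auto
  also have "\<dots> = 2 powr p * (max \<bar>a\<bar> \<bar>b\<bar>) powr p"
    by (simp add: powr_mult)
  also have "\<dots> \<le> 2 powr p * (\<bar>a\<bar> powr p + \<bar>b\<bar> powr p)"
    by (intro mult_left_mono) (auto simp: max_def)
  finally show ?thesis .
qed

lemma local_mass_add:
  assumes "p > 0" and "V \<in> borel_measurable lebesgue" "W \<in> borel_measurable lebesgue"
  shows "local_mass p (\<lambda>x. V x + W x) x \<le> ennreal (2 powr p) * (local_mass p V x + local_mass p W x)"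
proof -
  have "local_mass p (\<lambda>x. V x + W x) x \<le>
     (\<integral>\<^sup>+y. ennreal (2 powr p) * (ennreal (\<bar>V y\<bar> powr p) * indicator (ball x 1) y + ennreal (\<bar>W y\<bar> powr p) * indicator (ball x 1) y) \<partial>lebesgue)"
    unfolding local_mass_def
    using powr_add_le[OF \<open>p > 0\<close>]
    by (intro nn_integral_mono)
       (auto simp: indicator_def ennreal_mult' [symmetric] ennreal_plus[symmetric] simp del: ennreal_plus intro!: ennreal_leI)
  also have "\<dots> = ennreal (2 powr p) * (local_mass p V x + local_mass p W x)"
    unfolding local_mass_def
    by (subst nn_integral_cmult nn_integral_add;
        (intro borel_measurable_add restricted_powr_measurable)?; (use assms in auto)?)+
  finally show ?thesis .
qed

lemma LU_local_massE:
  assumes "p > 0" "V \<in> LU p"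
  obtains K where "0 \<le> K" "\<And>x. local_mass p V x \<le> ennreal K"
  using local_mass_le_LU_norm[OF assms] by (metis powr_ge_zero)

lemma LU_add:
  assumes "p > 0" "V \<in> LU p" "W \<in> LU p"
  shows "(\<lambda>x. V x + W x) \<in> LU p"
proof -
  obtain K L where K: "0 \<le> K" "\<And>x. local_mass p V x \<le> ennreal K"
    and L: "0 \<le> L" "\<And>x. local_mass p W x \<le> ennreal L"
    using assms LU_local_massE by metis
  show ?thesis
  proof (rule LU_I)
    fix x
    have "local_mass p (\<lambda>x. V x + W x) x \<le> ennreal (2 powr p) * (local_mass p V x + local_mass p W x)"
      by (rule local_mass_add) (use assms in \<open>auto intro: LU_measurable\<close>)
    also have "\<dots> \<le> ennreal (2 powr p) * (ennreal K + ennreal L)"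
      by (intro mult_left_mono add_mono K L) auto
    also have "\<dots> = ennreal (2 powr p * (K + L))"
      using K(1) L(1) by (simp add: ennreal_mult)
    finally show "local_mass p (\<lambda>x. V x + W x) x \<le> ennreal (2 powr p * (K + L))" .
  qed (use assms in \<open>auto intro!: borel_measurable_add borel_measurable_times dest: LU_measurable\<close>)
qed

lemma LU_cmult:
  assumes "p > 0" "V \<in> LU p"
  shows "(\<lambda>x. c * V x) \<in> LU p"
proof -
  obtain K where K: "0 \<le> K" "\<And>x. local_mass p V x \<le> ennreal K"
    using assms LU_local_massE by metis
  show ?thesis
  proof (rule LU_I)
    fix x
    show "local_mass p (\<lambda>x. c * V x) x \<le> ennreal (\<bar>c\<bar> powr p * K)"
      using K assms(2)[THEN LU_measurable] by (simp add: local_mass_cmult ennreal_mult mult_left_mono)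
  qed (use assms in \<open>auto intro!: borel_measurable_add borel_measurable_times dest: LU_measurable\<close>)
qed

lemma LU_diff:
  assumes "p > 0" "V \<in> LU p" "W \<in> LU p"
  shows "(\<lambda>x. V x - W x) \<in> LU p"
  using LU_add[OF assms(1,2) LU_cmult[OF assms(1,3), of "-1"]] by simp

text \<open>All unit balls have the same finite volume, so an essential bound gives a mass bound
  that does not depend on the centre.\<close>

lemma Linfty_subset_LU:
  assumes "p > 0" "W \<in> Linfty"
  shows "W \<in> LU p"
proof -
  obtain C where C: "AE x in lebesgue. \<bar>W x\<bar> \<le> C" using assms by (auto simp: Linfty_def)
  show ?thesis
  proof (rule LU_I)
    fix x :: 'a
    have "local_mass p W x \<le> local_mass p (\<lambda>_. C) x"
      by (rule local_mass_mono[OF assms(1)], rule eventually_mono[OF C]) auto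
    also have "\<dots> = ennreal (\<bar>C\<bar> powr p * unit_ball_vol DIM('a))"
      by (simp add: local_mass_def nn_integral_cmult_indicator emeasure_ball ennreal_mult)
    finally show "local_mass p W x \<le> ennreal (\<bar>C\<bar> powr p * unit_ball_vol DIM('a))" .
  qed (use assms in \<open>auto intro: Linfty_measurable\<close>)
qed

section \<open>Approximability by bounded functions and truncation\<close>

text \<open>Trades the approximating sequence for one bounded function per error level; the levels
  \<open>inverse (real (Suc n))\<close> give a sequence back.\<close>

lemma bounded_approximable_iff:
  assumes "p > 0" "V \<in> LU p"
  shows "bounded_approximable p V \<longleftrightarrow>
    (\<forall>e>0. \<exists>W\<in>Linfty. \<forall>x. local_mass p (\<lambda>y. W y - V y) x \<le> ennreal e)"
proof -
  have *: "(\<lambda>n. LU_norm p (\<lambda>x. W n x - V x)) \<longlonglongrightarrow> 0 \<longleftrightarrow>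
      (\<forall>e>0. \<forall>\<^sub>F n in sequentially. \<forall>x. local_mass p (\<lambda>y. W n y - V y) x \<le> ennreal e)"
    if "\<forall>n. W n \<in> Linfty" for W :: "nat \<Rightarrow> 'a \<Rightarrow> real"
    using that assms by (intro LU_norm_tendsto_0_iff always_eventually) (blast intro: LU_diff Linfty_subset_LU)+
  show ?thesis
  proof
    assume "bounded_approximable p V"
    then obtain W :: "nat \<Rightarrow> 'a \<Rightarrow> real" where W: "\<forall>n. W n \<in> Linfty"
      "(\<lambda>n. LU_norm p (\<lambda>x. W n x - V x)) \<longlonglongrightarrow> 0"
      unfolding bounded_approximable_def by blast
    show "\<forall>e>0. \<exists>W\<in>Linfty. \<forall>x. local_mass p (\<lambda>y. W y - V y) x \<le> ennreal e"
    proof (intro allI impI)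
      fix e :: real assume "e > 0"
      then have "\<forall>\<^sub>F n in sequentially. \<forall>x. local_mass p (\<lambda>y. W n y - V y) x \<le> ennreal e"
        using W(2) unfolding *[OF W(1)] by blast
      then obtain n where "\<forall>x. local_mass p (\<lambda>y. W n y - V y) x \<le> ennreal e"
        using eventually_happens'[OF sequentially_bot] by blast
      with W(1) show "\<exists>W\<in>Linfty. \<forall>x. local_mass p (\<lambda>y. W y - V y) x \<le> ennreal e" by blast
    qed
  next
    assume "\<forall>e>0. \<exists>W\<in>Linfty. \<forall>x. local_mass p (\<lambda>y. W y - V y) x \<le> ennreal e"
    then have "\<forall>n. \<exists>W\<in>Linfty. \<forall>x. local_mass p (\<lambda>y. W y - V y) x \<le> ennreal (inverse (real (Suc n)))"
      by simp
    then obtain W where W: "\<forall>n. W n \<in> Linfty"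
      "\<And>n x. local_mass p (\<lambda>y. W n y - V y) x \<le> ennreal (inverse (real (Suc n)))"
      by metis
    have "(\<lambda>n. LU_norm p (\<lambda>x. W n x - V x)) \<longlonglongrightarrow> 0"
      unfolding *[OF W(1)]
    proof (intro allI impI)
      fix e :: real assume "e > 0"
      then have "\<forall>\<^sub>F n in sequentially. inverse (real (Suc n)) < e"
        by (intro order_tendstoD(2)[OF LIMSEQ_inverse_real_of_nat])
      then show "\<forall>\<^sub>F n in sequentially. \<forall>x. local_mass p (\<lambda>y. W n y - V y) x \<le> ennreal e"
        by eventually_elim (blast intro: order_trans[OF W(2) ennreal_leI] less_imp_le)
    qed
    with W(1) show "bounded_approximable p V"
      unfolding bounded_approximable_def by blast
  qed
qed

lemma abs_truncate_le: "0 \<le> M \<Longrightarrow> \<bar>truncate M V x\<bar> \<le> M"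
  by (auto simp: truncate_def)

text \<open>Truncation is the nearest-point projection onto \<open>[-M, M]\<close>. Different
  choices of \<open>w\<close> give monotonicity of the error in \<open>M\<close>, domination by the
  function itself, optimality among bounded approximants and the oscillation bound.\<close>

lemma truncate_nearest: "\<bar>w\<bar> \<le> M \<Longrightarrow> \<bar>truncate M V x - V x\<bar> \<le> \<bar>w - V x\<bar>"
  by (auto simp: truncate_def)

lemma truncate_measurable:
  assumes "0 \<le> M" and V: "V \<in> borel_measurable N"
  shows "truncate M V \<in> borel_measurable N"
proof -
  have "truncate M V = (\<lambda>x. max (- M) (min M (V x)))"
    using \<open>0 \<le> M\<close> by (auto simp: truncate_def fun_eq_iff)
  then show ?thesis using V by simp
qed

lemma truncate_in_Linfty:
  assumes "0 \<le> M" "V \<in> borel_measurable lebesgue"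
  shows "truncate M V \<in> Linfty"
  using assms truncate_measurable abs_truncate_le[of M V]
  by (auto simp: Linfty_def intro!: exI[of _ M] always_eventually)

lemma truncate_diff_in_LU:
  assumes "p > 0" "0 \<le> M" "V \<in> LU p"
  shows "(\<lambda>x. truncate M V x - V x) \<in> LU p"
  using LU_diff[OF _ Linfty_subset_LU[OF _ truncate_in_Linfty[OF _ LU_measurable]]] assms by blast

text \<open>The error decreases as the level grows, because truncation at a lower level is a
  competitor at every higher one. Hence a single good level for each \<open>e\<close> already gives
  the limit.\<close>

lemma truncate_tendsto_iff:
  assumes "p > 0" "V \<in> LU p"
  shows "((\<lambda>M. LU_norm p (\<lambda>x. truncate M V x - V x)) \<longlongrightarrow> 0) at_top \<longleftrightarrow>
    (\<forall>e>0. \<exists>M\<ge>0. \<forall>x. local_mass p (\<lambda>y. truncate M V y - V y) x \<le> ennreal e)" (is "_ \<longleftrightarrow> ?R")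
proof -
  have "\<forall>\<^sub>F M in at_top. (\<lambda>x. truncate M V x - V x) \<in> LU p"
    using eventually_ge_at_top[of 0]
    by eventually_elim (use assms in \<open>blast intro: truncate_diff_in_LU\<close>)
  then have "((\<lambda>M. LU_norm p (\<lambda>x. truncate M V x - V x)) \<longlongrightarrow> 0) at_top \<longleftrightarrow>
      (\<forall>e>0. \<forall>\<^sub>F M in at_top. \<forall>x. local_mass p (\<lambda>y. truncate M V y - V y) x \<le> ennreal e)"
    by (rule LU_norm_tendsto_0_iff[OF assms(1)])
  also have "\<dots> \<longleftrightarrow> ?R"
  proof (intro all_cong iffI)
    fix e :: real
    assume "\<forall>\<^sub>F M in at_top. \<forall>x. local_mass p (\<lambda>y. truncate M V y - V y) x \<le> ennreal e"
    then show "\<exists>M\<ge>0. \<forall>x. local_mass p (\<lambda>y. truncate M V y - V y) x \<le> ennreal e"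
      \<comment> \<open>The witness is the maximum of 0 and the threshold of the eventual
        statement.\<close>
      unfolding eventually_at_top_linorder by (meson max.cobounded1 max.cobounded2)
  next
    fix e :: real
    assume "\<exists>M\<ge>0. \<forall>x. local_mass p (\<lambda>y. truncate M V y - V y) x \<le> ennreal e"
    then obtain M where M: "M \<ge> 0" "\<And>x. local_mass p (\<lambda>y. truncate M V y - V y) x \<le> ennreal e"
      by blast
    show "\<forall>\<^sub>F M in at_top. \<forall>x. local_mass p (\<lambda>y. truncate M V y - V y) x \<le> ennreal e"
      using eventually_ge_at_top[of M]
    proof eventually_elim
      case (elim M')
      have "local_mass p (\<lambda>y. truncate M' V y - V y) x \<le> local_mass p (\<lambda>y. truncate M V y - V y) x" for x
        using elim M(1) abs_truncate_le[of M V]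
        by (intro local_mass_mono[OF assms(1)] always_eventually allI truncate_nearest)
           (meson order_trans)
      with M(2) show ?case by (meson order_trans)
    qed
  qed
  finally show ?thesis .
qed

text \<open>An approximant bounded almost everywhere by \<open>C\<close> is a competitor at level
  \<open>\<bar>C\<bar>\<close>, so truncation there is at least as good; conversely, truncations are
  bounded approximants.\<close>

lemma bounded_approximable_iff_truncate:
  assumes "p > 0" "V \<in> LU p"
  shows "bounded_approximable p V \<longleftrightarrow>
    ((\<lambda>M. LU_norm p (\<lambda>x. truncate M V x - V x)) \<longlongrightarrow> 0) at_top"
  unfolding truncate_tendsto_iff[OF assms] bounded_approximable_iff[OF assms]
proof (intro all_cong iffI)
  fix e :: real
  assume "\<exists>W\<in>Linfty. \<forall>x. local_mass p (\<lambda>y. W y - V y) x \<le> ennreal e"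
  then obtain W where W: "W \<in> Linfty" "\<And>x. local_mass p (\<lambda>y. W y - V y) x \<le> ennreal e"
    by blast
  then obtain C where C: "AE x in lebesgue. \<bar>W x\<bar> \<le> C" by (auto simp: Linfty_def)
  have "local_mass p (\<lambda>y. truncate \<bar>C\<bar> V y - V y) x \<le> local_mass p (\<lambda>y. W y - V y) x" for x
    by (intro local_mass_mono[OF assms(1)] eventually_mono[OF C] truncate_nearest) auto
  with W(2) show "\<exists>M\<ge>0. \<forall>x. local_mass p (\<lambda>y. truncate M V y - V y) x \<le> ennreal e"
    by (meson abs_ge_zero order_trans)
next
  fix e :: real
  assume "\<exists>M\<ge>0. \<forall>x. local_mass p (\<lambda>y. truncate M V y - V y) x \<le> ennreal e"
  then show "\<exists>W\<in>Linfty. \<forall>x. local_mass p (\<lambda>y. W y - V y) x \<le> ennreal e"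
    using truncate_in_Linfty LU_measurable[OF assms(2)] by blast
qed

section \<open>Truncation under the tail condition\<close>

text \<open>For centres outside radius \<open>R\<close> the error at level \<open>M\<^sub>0\<close>
  is at most \<open>e\<close> and does not increase at higher levels. Unit balls with the remaining
  centres lie in \<open>ball 0 (R + 1)\<close>, where one dominated convergence serves them
  simultaneously.\<close>

lemma truncate_tendsto_of_tail:
  fixes V :: "'a::euclidean_space \<Rightarrow> real"
  assumes "p > 0" "V \<in> LU p" "M\<^sub>0 > 0"
    and tail: "((\<lambda>x. LINT y:ball x 1|lebesgue. \<bar>V y - truncate M\<^sub>0 V y\<bar> powr p) \<longlongrightarrow> 0) at_infinity"
  shows "((\<lambda>M. LU_norm p (\<lambda>x. truncate M V x - V x)) \<longlongrightarrow> 0) at_top"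
  unfolding truncate_tendsto_iff[OF assms(1,2)]
proof (intro allI impI)
  fix e :: real assume "e > 0"
  define T where "T M y = truncate M V y - V y" for M y
  have V: "V \<in> borel_measurable lebesgue" using assms LU_measurable by blast
  have T: "T M \<in> LU p" if "0 \<le> M" for M
    unfolding T_def using truncate_diff_in_LU assms that by blast
  have "\<forall>\<^sub>F x in at_infinity. (LINT y:ball x 1|lebesgue. \<bar>V y - truncate M\<^sub>0 V y\<bar> powr p) < e"
    using tail \<open>e > 0\<close> by (intro order_tendstoD(2))
  then obtain R where R:
    "\<And>x. R \<le> norm x \<Longrightarrow> (LINT y:ball x 1|lebesgue. \<bar>V y - truncate M\<^sub>0 V y\<bar> powr p) < e"
    by (auto simp: eventually_at_infinity)
  have far: "local_mass p (T M\<^sub>0) x \<le> ennreal e" if "R \<le> norm x" for x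
  proof -
    have "set_integrable lebesgue (ball x 1) (\<lambda>y. \<bar>T M\<^sub>0 y\<bar> powr p)"
      using T[of M\<^sub>0] \<open>M\<^sub>0 > 0\<close> by (intro Lp_loc_set_integrable_ball) (simp add: LU_def)
    from local_mass_eq_set_integral[OF this] show ?thesis
      using R[OF that] by (simp add: T_def[abs_def] abs_minus_commute ennreal_leI)
  qed
  define I where "I n = (\<integral>\<^sup>+y\<in>ball 0 (R + 1). ennreal (\<bar>T (real n) y\<bar> powr p) \<partial>lebesgue)" for n
  have "I \<longlonglongrightarrow> (\<integral>\<^sup>+y. 0 \<partial>(lebesgue :: 'a measure))"
    unfolding I_def
  proof (rule nn_integral_dominated_convergence)
    show "(\<lambda>y. ennreal (\<bar>T (real n) y\<bar> powr p) * indicator (ball 0 (R + 1)) y) \<in> borel_measurable lebesgue" for n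
      using LU_measurable[OF T[of "real n"]] by (intro restricted_powr_measurable) auto
    show "(\<lambda>y. ennreal (\<bar>V y\<bar> powr p) * indicator (ball 0 (R + 1)) y) \<in> borel_measurable lebesgue"
      using V by (intro restricted_powr_measurable) auto
    \<comment> \<open>Comparison with the value 0, which lies in every interval
      \<open>[-n, n]\<close>, provides the dominating function.\<close>
    have "\<bar>T (real n) y\<bar> \<le> \<bar>V y\<bar>" for n y
      unfolding T_def using truncate_nearest[of 0 "real n" V y] by simp
    then show "AE y in lebesgue. ennreal (\<bar>T (real n) y\<bar> powr p) * indicator (ball 0 (R + 1)) y
         \<le> ennreal (\<bar>V y\<bar> powr p) * indicator (ball 0 (R + 1)) y" for n
      using \<open>p > 0\<close> by (intro always_eventually allI mult_right_mono ennreal_leI powr_mono2) auto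
    have "set_integrable lebesgue (ball 0 (R + 1)) (\<lambda>y. \<bar>V y\<bar> powr p)"
      by (rule set_integrable_subset[of _ "cball 0 (R + 1)"])
         (use assms(2) in \<open>auto simp: LU_def Lp_loc_def\<close>)
    then have "(\<integral>\<^sup>+y. ennreal (norm (indicator (ball 0 (R + 1)) y *\<^sub>R \<bar>V y\<bar> powr p)) \<partial>lebesgue) < \<infinity>"
      unfolding set_integrable_def integrable_iff_bounded by simp
    also have "(\<integral>\<^sup>+y. ennreal (norm (indicator (ball 0 (R + 1)) y *\<^sub>R \<bar>V y\<bar> powr p)) \<partial>lebesgue) =
        (\<integral>\<^sup>+y\<in>ball 0 (R + 1). ennreal (\<bar>V y\<bar> powr p) \<partial>lebesgue)"
      by (rule nn_integral_cong) (auto simp: indicator_def)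
    finally show "(\<integral>\<^sup>+y\<in>ball 0 (R + 1). ennreal (\<bar>V y\<bar> powr p) \<partial>lebesgue) < \<infinity>" .
    \<comment> \<open>Since \<open>V y\<close> is a real number, high levels leave it unchanged:
      pointwise convergence is eventual equality.\<close>
    have ev: "\<forall>\<^sub>F n in sequentially. T (real n) y = 0" for y
    proof -
      obtain k where "\<bar>V y\<bar> \<le> real k" using real_arch_simple by blast
      then show ?thesis
        unfolding eventually_sequentially by (intro exI[of _ k]) (auto simp: T_def truncate_def)
    qed
    have "(\<lambda>n. ennreal (\<bar>T (real n) y\<bar> powr p) * indicator (ball 0 (R + 1)) y) \<longlonglongrightarrow> 0" for y
      by (intro tendsto_eventually eventually_mono[OF ev[of y]]) simp
    then show "AE y in lebesgue. (\<lambda>n. ennreal (\<bar>T (real n) y\<bar> powr p) * indicator (ball 0 (R + 1)) y) \<longlonglongrightarrow> 0"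
      by simp
  qed auto
  then have "\<forall>\<^sub>F n in sequentially. I n < ennreal e"
    using \<open>e > 0\<close> by (intro order_tendstoD(2)[of I 0]) auto
  moreover have "\<forall>\<^sub>F n in sequentially. M\<^sub>0 \<le> real n"
    using filterlim_real_sequentially by (simp add: filterlim_at_top)
  ultimately obtain n where n: "I n < ennreal e" "M\<^sub>0 \<le> real n"
    using eventually_happens'[OF sequentially_bot eventually_conj] by blast
  have "local_mass p (T (real n)) x \<le> ennreal e" for x
  proof (cases "R \<le> norm x")
    case True
    have "local_mass p (T (real n)) x \<le> local_mass p (T M\<^sub>0) x"
      using n(2) abs_truncate_le[of M\<^sub>0 V] assms(3) unfolding T_def
      by (intro local_mass_mono[OF assms(1)] always_eventually allI truncate_nearest)
         (meson order_trans less_imp_le)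
    with far[OF True] show ?thesis by (rule order_trans[rotated])
  next
    case False
    then have "ball x 1 \<subseteq> ball 0 (R + 1)"
      by (auto simp: dist_norm intro!: order.strict_trans1[OF norm_triangle_sub[of _ x]] simp: norm_minus_commute)
    then have "local_mass p (T (real n)) x \<le> I n"
      unfolding local_mass_def I_def
      by (intro nn_integral_mono mult_left_mono) (auto simp: indicator_def)
    with n(1) show ?thesis by auto
  qed
  then show "\<exists>M\<ge>0. \<forall>x. local_mass p (\<lambda>y. truncate M V y - V y) x \<le> ennreal e"
    unfolding T_def by (intro exI[of _ "real n"]) auto
qed

section \<open>Translation invariance and Borel representatives\<close>

lemma nn_integral_lborel_shift:
  fixes f :: "'a::euclidean_space \<Rightarrow> ennreal"
  assumes "f \<in> borel_measurable borel"
  shows "(\<integral>\<^sup>+x. f (c + x) \<partial>lborel) = (\<integral>\<^sup>+x. f x \<partial>lborel)"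
proof -
  have "(\<integral>\<^sup>+x. f x \<partial>lborel) = (\<integral>\<^sup>+x. f x \<partial>distr lborel borel ((+) c))"
    by (simp only: lborel_distr_plus)
  also have "\<dots> = (\<integral>\<^sup>+x. f (c + x) \<partial>lborel)"
    by (rule nn_integral_distr) (use assms in auto)
  finally show ?thesis ..
qed

lemma AE_lborel_shift:
  fixes c :: "'a::euclidean_space"
  assumes "AE x in lborel. P x"
  shows "AE x in lborel. P (c + x)"
proof -
  have "AE x in distr lborel borel ((+) c). P x"
    using assms by (simp only: lborel_distr_plus)
  then show ?thesis
    by (rule AE_distrD[rotated]) simp
qed

text \<open>Passes from the completed measure to \<open>lborel\<close> and from a Lebesgue
  measurable function to a Borel representative, for which shifts and exchange of integrals
  apply.\<close>

lemma local_mass_cong_AE: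
  assumes "AE y in lborel. V y = W y"
  shows "local_mass p V x = (\<integral>\<^sup>+y\<in>ball x 1. ennreal (\<bar>W y\<bar> powr p) \<partial>lborel)"
  unfolding local_mass_def nn_integral_completion
  by (rule nn_integral_cong_AE, rule eventually_mono[OF assms]) simp

lemma translate_measurable:
  assumes V: "V \<in> borel_measurable lebesgue"
  shows "translate y V \<in> borel_measurable lebesgue"
proof -
  \<comment> \<open>Composition with a Lebesgue measurable function needs the shift to be measurable
    between the completed sigma-algebras. It is written as an affine map in coordinates with all
    scale factors 1.\<close>
  have "(\<lambda>x::'a. - y + (\<Sum>j\<in>Basis. (1 * (x \<bullet> j)) *\<^sub>R j)) \<in> lebesgue \<rightarrow>\<^sub>M lebesgue"
    by (rule lebesgue_affine_measurable) simp
  then have "(\<lambda>x. x - y) \<in> lebesgue \<rightarrow>\<^sub>M lebesgue"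
    by (simp add: euclidean_representation)
  from measurable_compose[OF this V] show ?thesis
    by (simp add: translate_def[abs_def])
qed

lemma local_mass_translate:
  assumes "V \<in> borel_measurable lebesgue"
  shows "local_mass p (translate y V) x = local_mass p V (x - y)"
proof -
  obtain U where U[measurable]: "U \<in> borel_measurable lborel" and ae: "AE z in lborel. V z = U z"
    using completion_ex_borel_measurable_real[OF assms] by blast
  have "local_mass p (translate y V) x = (\<integral>\<^sup>+z\<in>ball x 1. ennreal (\<bar>U (- y + z)\<bar> powr p) \<partial>lborel)"
    using AE_lborel_shift[OF ae, of "- y"] by (intro local_mass_cong_AE) (simp add: translate_def)
  \<comment> \<open>The indicator is expressed through \<open>- y + z\<close>, so that the whole
    integrand becomes a shifted function.\<close>
  also have "\<dots> = (\<integral>\<^sup>+z. ennreal (\<bar>U (- y + z)\<bar> powr p) * indicator (ball (x - y) 1) (- y + z) \<partial>lborel)"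
    by (rule nn_integral_cong) (auto simp: indicator_def dist_norm algebra_simps)
  also have "\<dots> = (\<integral>\<^sup>+z. ennreal (\<bar>U z\<bar> powr p) * indicator (ball (x - y) 1) z \<partial>lborel)"
    using U by (intro nn_integral_lborel_shift restricted_powr_measurable) auto
  also have "\<dots> = local_mass p V (x - y)"
    using ae by (rule local_mass_cong_AE[symmetric])
  finally show ?thesis .
qed

lemma translate_in_LU:
  assumes "p > 0" "V \<in> LU p"
  shows "translate y V \<in> LU p"
proof -
  obtain K where "\<And>x. local_mass p V x \<le> ennreal K"
    using assms LU_local_massE by metis
  then show ?thesis
    using assms by (intro LU_I[of _ _ K]) (auto simp: local_mass_translate LU_measurable translate_measurable)
qed

section \<open>Continuity of translations implies approximability\<close>

text \<open>By Markov's inequality the sublevel set \<open>\<bar>U\<bar> \<le> M\<close> fills half of \<open>ball z d\<close>, and on it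
  \<open>\<bar>U (z + y) - U z\<bar>\<close> dominates the distance from \<open>U z\<close> to \<open>[-M, M]\<close>.\<close>

lemma truncation_error_le_mean_oscillation:
  fixes U :: "'a::euclidean_space \<Rightarrow> real"
  assumes "p > 0" "M > 0" "0 < d" "d < 1" "0 \<le> K" and U[measurable]: "U \<in> borel_measurable borel"
    and K: "(\<integral>\<^sup>+y\<in>ball z 1. ennreal (\<bar>U y\<bar> powr p) \<partial>lborel) \<le> ennreal K"
    and large: "2 * K \<le> measure lborel (ball (0::'a) d) * M powr p"
  shows "ennreal (measure lborel (ball (0::'a) d) / 2) * ennreal (\<bar>truncate M U z - U z\<bar> powr p) \<le>
    (\<integral>\<^sup>+y\<in>ball 0 d. ennreal (\<bar>U (y + z) - U z\<bar> powr p) \<partial>lborel)"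
proof -
  define B where "B = ball (0::'a) d"
  define G where "G = {y\<in>B. \<bar>U (y + z)\<bar> \<le> M}"
  define H where "H = {y\<in>B. \<not> \<bar>U (y + z)\<bar> \<le> M}"
  have [measurable]: "G \<in> sets lborel" "H \<in> sets lborel" "B \<in> sets lborel"
    unfolding G_def H_def B_def by measurable
  have fin: "B \<in> fmeasurable lborel" "G \<in> fmeasurable lborel" "H \<in> fmeasurable lborel"
  proof -
    show B: "B \<in> fmeasurable lborel"
      using emeasure_lborel_ball_finite[of "0::'a" d] by (simp add: B_def fmeasurable_def)
    show "G \<in> fmeasurable lborel" "H \<in> fmeasurable lborel"
      by (rule fmeasurableI2[OF B]; auto simp: G_def H_def B_def)+
  qed
  have "ennreal (M powr p * measure lborel H) = ennreal (M powr p) * emeasure lborel H"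
    using fin(3) by (simp add: ennreal_mult' emeasure_eq_measure2)
  also have "\<dots> = (\<integral>\<^sup>+y. ennreal (M powr p) * indicator H y \<partial>lborel)"
    using \<open>H \<in> sets lborel\<close> by (subst nn_integral_cmult_indicator) auto
  \<comment> \<open>Since \<open>d < 1\<close>, the shifted set \<open>z + H\<close> lies in
    \<open>ball z 1\<close>, and there the function exceeds \<open>M\<close> in absolute
    value.\<close>
  also have "\<dots> \<le> (\<integral>\<^sup>+y. ennreal (\<bar>U (z + y)\<bar> powr p) * indicator (ball z 1) (z + y) \<partial>lborel)"
  proof (rule nn_integral_mono)
    fix y :: 'a
    show "ennreal (M powr p) * indicator H y \<le> ennreal (\<bar>U (z + y)\<bar> powr p) * indicator (ball z 1) (z + y)"
      using assms(1-4)
      by (auto simp: indicator_def H_def B_def dist_norm add.commute intro!: ennreal_leI powr_mono2)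
  qed
  also have "\<dots> = (\<integral>\<^sup>+y\<in>ball z 1. ennreal (\<bar>U y\<bar> powr p) \<partial>lborel)"
    by (rule nn_integral_lborel_shift[of "\<lambda>y. ennreal (\<bar>U y\<bar> powr p) * indicator (ball z 1) y" z])
       (intro restricted_powr_measurable, auto)
  also note K
  finally have "M powr p * measure lborel H \<le> K"
    using \<open>0 \<le> K\<close> by (simp add: ennreal_le_iff)
  then have "M powr p * (2 * measure lborel H) \<le> M powr p * measure lborel B"
    using large by (simp add: B_def algebra_simps)
  then have "2 * measure lborel H \<le> measure lborel B"
    using \<open>M > 0\<close> by simp
  moreover have "measure lborel B = measure lborel G + measure lborel H"
  proof -
    have "B = G \<union> H" "G \<inter> H = {}" by (auto simp: G_def H_def)
    then show ?thesis using fin measure_Union[of lborel G H] by (auto simp: fmeasurable_def)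
  qed
  ultimately have half: "measure lborel B / 2 \<le> measure lborel G" by simp
  have "ennreal (measure lborel B / 2) * ennreal (\<bar>truncate M U z - U z\<bar> powr p) \<le>
      emeasure lborel G * ennreal (\<bar>truncate M U z - U z\<bar> powr p)"
    using half fin(2) by (intro mult_right_mono) (simp_all add: emeasure_eq_measure2 ennreal_leI)
  also have "\<dots> = (\<integral>\<^sup>+y. ennreal (\<bar>truncate M U z - U z\<bar> powr p) * indicator G y \<partial>lborel)"
    using \<open>G \<in> sets lborel\<close> by (subst nn_integral_cmult_indicator) (auto simp: mult.commute)
  also have "\<dots> \<le> (\<integral>\<^sup>+y\<in>B. ennreal (\<bar>U (y + z) - U z\<bar> powr p) \<partial>lborel)"
    using \<open>p > 0\<close> truncate_nearest[of _ M U z]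
    by (intro nn_integral_mono) (auto simp: indicator_def G_def intro!: ennreal_leI powr_mono2)
  finally show ?thesis by (simp add: B_def)
qed

text \<open>Integrating the pointwise oscillation bound over \<open>ball x 1\<close> and exchanging
  the integrals leaves local masses of \<open>translate (- y) V - V\<close>, integrated over the
  small ball of shifts \<open>y\<close>.\<close>

lemma LU_dot_bounded_approximable:
  fixes V :: "'a::euclidean_space \<Rightarrow> real"
  assumes "p > 0" "V \<in> LU_dot p"
  shows "bounded_approximable p V"
proof -
  have V: "V \<in> LU p" using assms by (simp add: LU_dot_def)
  obtain K where K: "0 \<le> K" "\<And>x. local_mass p V x \<le> ennreal K"
    using assms(1) V LU_local_massE by metis
  \<comment> \<open>A Borel representative makes \<open>U (y + z)\<close> jointly measurable in
    \<open>y\<close> and \<open>z\<close>, as the exchange of integrals requires.\<close>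
  obtain U where U[measurable]: "U \<in> borel_measurable borel" and ae: "AE z in lborel. V z = U z"
    using completion_ex_borel_measurable_real[OF LU_measurable[OF V]] by auto
  have translates: "\<forall>e>0. \<forall>\<^sub>F y in at 0. \<forall>x. local_mass p (\<lambda>z. translate y V z - V z) x \<le> ennreal e"
  proof -
    have "\<forall>\<^sub>F y in at 0. (\<lambda>z. translate y V z - V z) \<in> LU p"
      using assms(1) V by (intro always_eventually allI LU_diff translate_in_LU)
    moreover have "((\<lambda>y. LU_norm p (\<lambda>z. translate y V z - V z)) \<longlongrightarrow> 0) (at 0)"
      using assms(2) by (simp add: LU_dot_def)
    ultimately show ?thesis
      by (rule LU_norm_tendsto_0_iff[OF assms(1), THEN iffD1])
  qed
  show ?thesis
    unfolding bounded_approximable_iff_truncate[OF assms(1) V] truncate_tendsto_iff[OF assms(1) V]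
  proof (intro allI impI)
    fix e :: real assume "e > 0"
    \<comment> \<open>Halving \<open>e\<close> compensates for the factor 2 that arises from using
      only half of the ball of shifts.\<close>
    then have "\<forall>\<^sub>F y in at 0. \<forall>x. local_mass p (\<lambda>z. translate y V z - V z) x \<le> ennreal (e / 2)"
      using translates by simp
    then obtain d\<^sub>0 where d\<^sub>0: "d\<^sub>0 > 0"
      "\<And>y x. \<lbrakk>y \<noteq> 0; norm y < d\<^sub>0\<rbrakk> \<Longrightarrow> local_mass p (\<lambda>z. translate y V z - V z) x \<le> ennreal (e / 2)"
      by (auto simp: eventually_at)
    \<comment> \<open>The cap \<open>1/2\<close> keeps the shifted ball inside a unit ball.\<close>
    define d where "d = min d\<^sub>0 (1/2)"
    have d: "0 < d" "d < 1" using d\<^sub>0 by (auto simp: d_def)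
    define \<mu> where "\<mu> = measure lborel (ball (0::'a) d)"
    have \<mu>: "\<mu> > 0" "emeasure lborel (ball (0::'a) d) = ennreal \<mu>"
      using d emeasure_lborel_ball_finite[of "0::'a" d]
      by (auto simp: \<mu>_def intro!: emeasure_eq_ennreal_measure)
    \<comment> \<open>Solves \<open>M powr p = 2 * K / \<mu> + 1\<close>, the threshold of the
      Markov estimate; the added 1 keeps \<open>M\<close> positive when
      \<open>K = 0\<close>.\<close>
    define M where "M = (2 * K / \<mu> + 1) powr (1 / p)"
    have "M powr p = 2 * K / \<mu> + 1"
      using K(1) \<mu>(1) \<open>p > 0\<close> by (simp add: M_def powr_powr add_nonneg_nonneg)
    then have large: "2 * K \<le> \<mu> * M powr p"
      using \<mu>(1) by (simp add: field_simps)
    have "M > 0"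
      using K(1) \<mu>(1) by (simp add: M_def) (smt (verit) divide_nonneg_pos)
    have UK: "(\<integral>\<^sup>+y\<in>ball z 1. ennreal (\<bar>U y\<bar> powr p) \<partial>lborel) \<le> ennreal K" for z
      using K(2)[of z] local_mass_cong_AE[OF ae, of p z] by simp
    have shift: "(\<integral>\<^sup>+z\<in>ball x 1. ennreal (\<bar>U (y + z) - U z\<bar> powr p) \<partial>lborel) \<le> ennreal (e / 2)"
      if "y \<in> ball 0 d" for x y
    \<comment> \<open>The filter \<open>at 0\<close> says nothing about \<open>y = 0\<close>, but
      there the integrand vanishes.\<close>
    proof (cases "y = 0")
      case False
      have "AE z in lborel. translate (- y) V z - V z = U (y + z) - U z"
        using ae AE_lborel_shift[OF ae, of y] by eventually_elim (simp add: translate_def add.commute)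
      from local_mass_cong_AE[OF this, of p x] show ?thesis
        using d\<^sub>0(2)[of "- y" x] that False by (simp add: d_def)
    qed simp
    have "local_mass p (\<lambda>y. truncate M V y - V y) x \<le> ennreal e" for x
    proof -
      have "AE z in lborel. truncate M V z - V z = truncate M U z - U z"
        using ae by eventually_elim (simp add: truncate_def)
      from local_mass_cong_AE[OF this]
      have "ennreal (\<mu> / 2) * local_mass p (\<lambda>y. truncate M V y - V y) x =
          ennreal (\<mu> / 2) * (\<integral>\<^sup>+z\<in>ball x 1. ennreal (\<bar>truncate M U z - U z\<bar> powr p) \<partial>lborel)"
        by simp
      also have "\<dots> = (\<integral>\<^sup>+z. ennreal (\<mu> / 2) * (ennreal (\<bar>truncate M U z - U z\<bar> powr p) * indicator (ball x 1) z) \<partial>lborel)"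
        using truncate_measurable[of M U borel] \<open>M > 0\<close>
        by (intro nn_integral_cmult[symmetric] restricted_powr_measurable borel_measurable_diff) auto
      also have "\<dots> \<le> (\<integral>\<^sup>+z. (\<integral>\<^sup>+y. ennreal (\<bar>U (y + z) - U z\<bar> powr p) * indicator (ball 0 d) y * indicator (ball x 1) z \<partial>lborel) \<partial>lborel)"
      proof (rule nn_integral_mono)
        fix z
        show "ennreal (\<mu> / 2) * (ennreal (\<bar>truncate M U z - U z\<bar> powr p) * indicator (ball x 1) z) \<le>
          (\<integral>\<^sup>+y. ennreal (\<bar>U (y + z) - U z\<bar> powr p) * indicator (ball 0 d) y * indicator (ball x 1) z \<partial>lborel)"
          using truncation_error_le_mean_oscillation[OF \<open>p > 0\<close> \<open>M > 0\<close> d K(1) U UK large[unfolded \<mu>_def], of z]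
          by (cases "z \<in> ball x 1") (simp_all add: \<mu>_def)
      qed
      \<comment> \<open>After the exchange, the inner integral at fixed \<open>y\<close> is the
        local mass of one translation difference and is at most \<open>e / 2\<close>, uniformly in
        \<open>y\<close>.\<close>
      also have "\<dots> = (\<integral>\<^sup>+y. (\<integral>\<^sup>+z. ennreal (\<bar>U (y + z) - U z\<bar> powr p) * indicator (ball 0 d) y * indicator (ball x 1) z \<partial>lborel) \<partial>lborel)"
      proof (rule lborel_pair.Fubini')
        have [measurable]: "ball 0 d \<in> sets (borel :: 'a measure)" "ball x 1 \<in> sets borel"
          by auto
        show "(\<lambda>(y, z). ennreal (\<bar>U (y + z) - U z\<bar> powr p) * indicator (ball 0 d) y * indicator (ball x 1) z)
            \<in> borel_measurable (lborel \<Otimes>\<^sub>M lborel)"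
          by measurable
      qed
      also have "\<dots> \<le> (\<integral>\<^sup>+y. ennreal (e / 2) * indicator (ball (0::'a) d) y \<partial>lborel)"
      proof (rule nn_integral_mono)
        fix y :: 'a
        show "(\<integral>\<^sup>+z. ennreal (\<bar>U (y + z) - U z\<bar> powr p) * indicator (ball 0 d) y * indicator (ball x 1) z \<partial>lborel)
          \<le> ennreal (e / 2) * indicator (ball 0 d) y"
          using shift[of y x] by (cases "y \<in> ball 0 d") simp_all
      qed
      also have "\<dots> = ennreal (e / 2) * ennreal \<mu>"
        by (simp add: nn_integral_cmult_indicator \<mu>(2))
      also have "\<dots> = ennreal (\<mu> / 2) * ennreal e"
        using \<mu>(1) \<open>e > 0\<close> by (simp add: ennreal_mult[symmetric] mult.commute)
      finally show ?thesis
        using \<mu>(1) by (simp add: ennreal_mult_le_mult_iff)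
    qed
    with \<open>M > 0\<close> show "\<exists>M\<ge>0. \<forall>x. local_mass p (\<lambda>y. truncate M V y - V y) x \<le> ennreal e"
      by (meson less_imp_le)
  qed
qed

section \<open>The approximable functions form a closed subspace\<close>

lemma fun_subspace_LU:
  assumes "p > 0"
  shows "fun_subspace (LU p :: ('a::euclidean_space \<Rightarrow> real) set)"
proof -
  have "(\<lambda>x::'a. 0) \<in> LU p"
    using Linfty_subset_LU[OF assms, of "\<lambda>_. 0"] by (force simp: Linfty_def)
  then show ?thesis
    unfolding fun_subspace_iff using LU_add LU_cmult assms by blast
qed

lemma Linfty_add:
  assumes "V \<in> Linfty" "W \<in> Linfty"
  shows "(\<lambda>x. V x + W x) \<in> Linfty"
proof -
  obtain C D where "AE x in lebesgue. \<bar>V x\<bar> \<le> C" "AE x in lebesgue. \<bar>W x\<bar> \<le> D"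
    using assms by (auto simp: Linfty_def)
  then have "AE x in lebesgue. \<bar>V x + W x\<bar> \<le> C + D"
    by eventually_elim auto
  then show ?thesis
    using assms by (auto simp: Linfty_def)
qed

lemma Linfty_cmult:
  assumes "V \<in> Linfty"
  shows "(\<lambda>x. c * V x) \<in> Linfty"
proof -
  obtain C where "AE x in lebesgue. \<bar>V x\<bar> \<le> C"
    using assms by (auto simp: Linfty_def)
  then have "AE x in lebesgue. \<bar>c * V x\<bar> \<le> \<bar>c\<bar> * C"
    by eventually_elim (simp add: abs_mult mult_left_mono)
  then show ?thesis
    using assms by (auto simp: Linfty_def intro!: borel_measurable_times)
qed

text \<open>An epsilon form of the quasi-triangle inequality, shared by the proofs of additivity and
  of closedness.\<close>

lemma local_mass_add_le:
  assumes "p > 0" "V \<in> borel_measurable lebesgue" "W \<in> borel_measurable lebesgue"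
    and "0 \<le> e" "2 powr p * (2 * d) \<le> e" "0 \<le> d"
    and "local_mass p V x \<le> ennreal d" "local_mass p W x \<le> ennreal d"
  shows "local_mass p (\<lambda>y. V y + W y) x \<le> ennreal e"
proof -
  have "local_mass p (\<lambda>y. V y + W y) x \<le> ennreal (2 powr p) * (local_mass p V x + local_mass p W x)"
    using assms by (intro local_mass_add)
  also have "\<dots> \<le> ennreal (2 powr p) * (ennreal d + ennreal d)"
    using assms by (intro mult_left_mono add_mono) auto
  also have "\<dots> = ennreal (2 powr p * (2 * d))"
    using \<open>0 \<le> d\<close> by (simp add: ennreal_mult flip: ennreal_plus)
  also have "\<dots> \<le> ennreal e"
    using assms by (intro ennreal_leI)
  finally show ?thesis .
qed

lemma obtain_quasi_triangle_error:
  fixes e p :: real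
  assumes "e > 0"
  obtains d where "d > 0" "2 powr p * (2 * d) \<le> e"
  by (rule that[of "e / (2 * 2 powr p)"]) (use assms in \<open>auto simp: field_simps\<close>)

lemma bounded_approximable_add:
  assumes "p > 0" and V: "V \<in> LU p" "bounded_approximable p V"
    and W: "W \<in> LU p" "bounded_approximable p W"
  shows "bounded_approximable p (\<lambda>x. V x + W x)"
  unfolding bounded_approximable_iff[OF assms(1) LU_add[OF assms(1) V(1) W(1)]]
proof (intro allI impI)
  fix e :: real assume "e > 0"
  then obtain d where d: "d > 0" "2 powr p * (2 * d) \<le> e"
    using obtain_quasi_triangle_error by metis
  obtain A where A: "A \<in> Linfty" "\<And>x. local_mass p (\<lambda>y. A y - V y) x \<le> ennreal d"
    using V d(1) unfolding bounded_approximable_iff[OF assms(1) V(1)] by blast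
  obtain B where B: "B \<in> Linfty" "\<And>x. local_mass p (\<lambda>y. B y - W y) x \<le> ennreal d"
    using W d(1) unfolding bounded_approximable_iff[OF assms(1) W(1)] by blast
  have "local_mass p (\<lambda>y. (A y - V y) + (B y - W y)) x \<le> ennreal e" for x
    using d \<open>e > 0\<close> A B V(1) W(1)
    by (intro local_mass_add_le[OF assms(1), of _ _ _ d] borel_measurable_diff)
       (auto intro: LU_measurable Linfty_measurable)
  then have "local_mass p (\<lambda>y. (A y + B y) - (V y + W y)) x \<le> ennreal e" for x
    by (simp add: algebra_simps)
  then show "\<exists>X\<in>Linfty. \<forall>x. local_mass p (\<lambda>y. X y - (V y + W y)) x \<le> ennreal e"
    by (intro bexI[OF _ Linfty_add[OF A(1) B(1)]]) blast
qed

lemma bounded_approximable_cmult: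
  assumes "p > 0" and V: "V \<in> LU p" "bounded_approximable p V"
  shows "bounded_approximable p (\<lambda>x. c * V x)"
  unfolding bounded_approximable_iff[OF assms(1) LU_cmult[OF assms(1) V(1)]]
proof (intro allI impI)
  fix e :: real assume "e > 0"
  \<comment> \<open>The added 1 keeps the denominator positive when \<open>c = 0\<close>.\<close>
  define d where "d = e / (\<bar>c\<bar> powr p + 1)"
  have pos: "\<bar>c\<bar> powr p + 1 > 0" by (simp add: add_nonneg_pos)
  then have d: "d > 0" "\<bar>c\<bar> powr p * d \<le> e"
    using \<open>e > 0\<close> by (auto simp: d_def field_simps)
  obtain A where A: "A \<in> Linfty" "\<And>x. local_mass p (\<lambda>y. A y - V y) x \<le> ennreal d"
    using V d(1) unfolding bounded_approximable_iff[OF assms(1) V(1)] by blast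
  have "local_mass p (\<lambda>y. c * A y - c * V y) x \<le> ennreal e" for x
  proof -
    have "local_mass p (\<lambda>y. c * (A y - V y)) x = ennreal (\<bar>c\<bar> powr p) * local_mass p (\<lambda>y. A y - V y) x"
      using A(1) V(1) by (intro local_mass_cmult borel_measurable_diff LU_measurable Linfty_measurable)
    also have "\<dots> \<le> ennreal (\<bar>c\<bar> powr p) * ennreal d"
      using A(2) by (intro mult_left_mono) auto
    also have "\<dots> \<le> ennreal e"
      using d by (simp add: ennreal_mult[symmetric] ennreal_leI)
    finally show ?thesis by (simp add: right_diff_distrib)
  qed
  then show "\<exists>X\<in>Linfty. \<forall>x. local_mass p (\<lambda>y. X y - c * V y) x \<le> ennreal e"
    by (intro bexI[OF _ Linfty_cmult[OF A(1)]]) blast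
qed

lemma bounded_approximable_Linfty:
  assumes "W \<in> Linfty"
  shows "bounded_approximable p W"
proof -
  have "LU_norm p (\<lambda>x::'a. 0) = 0"
    by (simp add: LU_norm_def Lp_norm_on_def)
  then show ?thesis
    unfolding bounded_approximable_def using assms by (intro exI[of _ "\<lambda>_. W"]) simp
qed

lemma fun_subspace_bounded_approximable:
  assumes "p > 0"
  shows "fun_subspace {V :: 'a::euclidean_space \<Rightarrow> real. V \<in> LU p \<and> bounded_approximable p V}"
proof -
  have zero: "(\<lambda>x::'a. 0) \<in> Linfty"
    by (force simp: Linfty_def)
  show ?thesis
    unfolding fun_subspace_iff
  proof (intro conjI ballI allI)
    show "(\<lambda>x. 0) \<in> {V :: 'a \<Rightarrow> real. V \<in> LU p \<and> bounded_approximable p V}"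
      using Linfty_subset_LU[OF assms zero] bounded_approximable_Linfty[OF zero] by simp
  next
    fix f g assume "f \<in> {V :: 'a \<Rightarrow> real. V \<in> LU p \<and> bounded_approximable p V}"
      "g \<in> {V :: 'a \<Rightarrow> real. V \<in> LU p \<and> bounded_approximable p V}"
    then show "(\<lambda>x. f x + g x) \<in> {V. V \<in> LU p \<and> bounded_approximable p V}"
      by (simp add: assms LU_add bounded_approximable_add)
  next
    fix c f assume "f \<in> {V :: 'a \<Rightarrow> real. V \<in> LU p \<and> bounded_approximable p V}"
    then show "(\<lambda>x. c * f x) \<in> {V. V \<in> LU p \<and> bounded_approximable p V}"
      by (simp add: assms LU_cmult bounded_approximable_cmult)
  qed
qed

text \<open>The complement is open: if \<open>V\<close> stays away from all bounded functions by
  \<open>e\<close>, so does every nearby \<open>W\<close> by a smaller \<open>d\<close>, because an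
  approximant \<open>B\<close> of \<open>W\<close> would approximate \<open>V\<close> through
  \<open>(B - W) + (W - V)\<close>.\<close>

lemma closedin_bounded_approximable:
  assumes "p > 0"
  shows "closedin (LU_topology p) {V :: 'a::euclidean_space \<Rightarrow> real. V \<in> LU p \<and> bounded_approximable p V}"
    (is "closedin _ ?A")
  unfolding closedin_def topspace_LU_topology openin_LU_topology
proof (intro conjI ballI)
  fix V assume "V \<in> LU p - ?A"
  then have V: "V \<in> LU p" "\<not> bounded_approximable p V" by auto
  then obtain e where e: "e > 0" "\<And>W. W \<in> Linfty \<Longrightarrow> \<not> (\<forall>x. local_mass p (\<lambda>y. W y - V y) x \<le> ennreal e)"
    unfolding bounded_approximable_iff[OF assms V(1)] by blast
  obtain d where d: "d > 0" "2 powr p * (2 * d) \<le> e"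
    using obtain_quasi_triangle_error e(1) by metis
  show "\<exists>r>0. \<forall>W\<in>LU p. LU_norm p (\<lambda>x. W x - V x) < r \<longrightarrow> W \<in> LU p - ?A"
  \<comment> \<open>The seminorm contains the p-th root, so a mass bound \<open>d\<close>
    corresponds to the radius \<open>d powr (1 / p)\<close>.\<close>
  proof (intro exI[of _ "d powr (1 / p)"] conjI ballI impI)
    show "d powr (1 / p) > 0" using d by simp
    fix W assume W: "W \<in> LU p" and less: "LU_norm p (\<lambda>x. W x - V x) < d powr (1 / p)"
    have WV: "local_mass p (\<lambda>y. W y - V y) x \<le> ennreal d" for x
    proof -
      note diff = LU_diff[OF assms W V(1)]
      have "LU_norm p (\<lambda>x. W x - V x) powr p \<le> (d powr (1 / p)) powr p"
        using less LU_norm_nonneg[OF diff] assms by (intro powr_mono2) auto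
      also have "\<dots> = d" using d assms by (simp add: powr_powr)
      finally show ?thesis
        by (intro order_trans[OF local_mass_le_LU_norm[OF assms diff]] ennreal_leI)
    qed
    have "\<not> bounded_approximable p W"
    proof
      assume "bounded_approximable p W"
      then obtain B where B: "B \<in> Linfty" "\<And>x. local_mass p (\<lambda>y. B y - W y) x \<le> ennreal d"
        using d(1) unfolding bounded_approximable_iff[OF assms W] by blast
      have "local_mass p (\<lambda>y. (B y - W y) + (W y - V y)) x \<le> ennreal e" for x
        using d e(1) WV B V(1) W
        by (intro local_mass_add_le[OF assms, of _ _ _ d] borel_measurable_diff)
           (auto intro: LU_measurable Linfty_measurable)
      with e(2)[OF B(1)] show False by simp
    qed
    with W show "W \<in> LU p - ?A" by blast
  qed
qed auto

section \<open>A function in \<open>LU\<close> that bounded functions do not approximate\<close>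

text \<open>The counterexample has height \<open>n + 1\<close> on a ball around \<open>(4 * n) *\<^sub>R b\<close> whose radius is chosen so
  that the \<open>p\<close>-mass of the spike does not depend on \<open>n\<close>; the spacing lets a unit ball meet at most
  one spike.\<close>

definition spike_radius :: "real \<Rightarrow> 'a::euclidean_space itself \<Rightarrow> nat \<Rightarrow> real" where
  "spike_radius p _ n = (real n + 1) powr (- p / real DIM('a))"

definition spike :: "real \<Rightarrow> 'a::euclidean_space \<Rightarrow> nat \<Rightarrow> 'a set" where
  "spike p b n = ball ((4 * real n) *\<^sub>R b) (spike_radius p TYPE('a) n)"

text \<open>The slabs \<open>4 * n - 2 \<le> x \<bullet> b < 4 * n + 2\<close> are centred at the
  spikes. Points further to the left get the default index 0, which is harmless because
  \<open>spikes\<close> also tests membership in the spike.\<close>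

definition spike_index :: "'a::euclidean_space \<Rightarrow> 'a \<Rightarrow> nat" where
  "spike_index b x = nat \<lfloor>(x \<bullet> b + 2) / 4\<rfloor>"

text \<open>Selecting the only possible index replaces an infinite sum over spikes and leaves an
  explicit formula.\<close>

definition spikes :: "real \<Rightarrow> 'a::euclidean_space \<Rightarrow> 'a \<Rightarrow> real" where
  "spikes p b x = (if x \<in> spike p b (spike_index b x) then real (spike_index b x) + 1 else 0)"

lemma spike_radius_le_1: "p > 0 \<Longrightarrow> spike_radius p TYPE('a::euclidean_space) n \<le> 1"
  using powr_mono[of "- p / real DIM('a)" 0 "real n + 1"]
  by (simp add: spike_radius_def)

lemma spike_subset_ball: "p > 0 \<Longrightarrow> spike p b n \<subseteq> ball ((4 * real n) *\<^sub>R b) 1"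
  unfolding spike_def by (intro subset_ball spike_radius_le_1)

text \<open>The volume scales like the radius to the power of the dimension, that is
  \<open>(real n + 1) powr (- p)\<close>, which cancels the p-th power of the height. The factor
  \<open>a\<close> covers both full height and half height.\<close>

lemma spike_mass:
  assumes "a \<ge> 0"
  shows "ennreal ((a * (real n + 1)) powr p) * emeasure lebesgue (spike p (b::'a::euclidean_space) n) =
    ennreal (a powr p * unit_ball_vol DIM('a))"
proof -
  have "spike_radius p TYPE('a) n ^ DIM('a) = (real n + 1) powr (- p)"
    by (simp add: spike_radius_def powr_power)
  moreover have "(real n + 1) powr p * (real n + 1) powr (- p) = 1"
    by (simp flip: powr_add)
  moreover have "emeasure lebesgue (spike p b n) =
      ennreal (unit_ball_vol DIM('a) * spike_radius p TYPE('a) n ^ DIM('a))"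
    unfolding spike_def by (simp add: emeasure_ball spike_radius_def)
  ultimately show ?thesis
    using assms by (simp add: powr_mult ennreal_mult[symmetric] mult.assoc mult.left_commute)
qed

lemma spike_inner:
  assumes "p > 0" "b \<in> Basis" "y \<in> spike p b n"
  shows "\<bar>y \<bullet> b - 4 * real n\<bar> < 1"
proof -
  have "\<bar>(y - (4 * real n) *\<^sub>R b) \<bullet> b\<bar> \<le> norm (y - (4 * real n) *\<^sub>R b)"
    using Basis_le_norm[OF assms(2)] .
  also have "\<dots> < 1"
    using subsetD[OF spike_subset_ball[OF assms(1)] assms(3)] by (simp add: dist_norm norm_minus_commute)
  finally show ?thesis
    using assms(2) by (simp add: inner_diff_left)
qed

lemma spike_index_eq:
  assumes "p > 0" "b \<in> Basis" "y \<in> spike p b n"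
  shows "spike_index b y = n"
proof -
  \<comment> \<open>The quotient lies strictly between \<open>n + 1/4\<close> and
    \<open>n + 3/4\<close>.\<close>
  have "\<lfloor>(y \<bullet> b + 2) / 4\<rfloor> = int n"
    using spike_inner[OF assms] by (intro floor_unique) auto
  then show ?thesis by (simp add: spike_index_def)
qed

lemma spikes_eq:
  assumes "p > 0" "b \<in> Basis" "y \<in> spike p b n"
  shows "spikes p b y = real n + 1"
  using spike_index_eq[OF assms] assms(3) by (simp add: spikes_def)

lemma spikes_measurable: "spikes p b \<in> borel_measurable borel"
proof -
  \<comment> \<open>The natural index becomes the real number \<open>k\<close>, so that the formula
    is built from Borel operations only.\<close>
  have "spikes p b = (\<lambda>x. let k = max 0 (real_of_int \<lfloor>(x \<bullet> b + 2) / 4\<rfloor>) in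
      if dist ((4 * k) *\<^sub>R b) x < (k + 1) powr (- p / real DIM('a)) then k + 1 else 0)"
    by (auto simp: fun_eq_iff spikes_def spike_def spike_index_def spike_radius_def Let_def max_def)
  also have "\<dots> \<in> borel_measurable borel"
    unfolding Let_def by measurable
  finally show ?thesis .
qed

text \<open>A unit ball meets at most one spike, so each local mass is at most the common mass of a
  spike, the volume of the unit ball.\<close>

lemma spikes_in_LU:
  fixes b :: "'a::euclidean_space"
  assumes "p > 0" "b \<in> Basis"
  shows "spikes p b \<in> LU p"
proof (rule LU_I)
  show "spikes p b \<in> borel_measurable lebesgue"
    using spikes_measurable by (intro measurable_completion) simp
  show "local_mass p (spikes p b) x \<le> ennreal (unit_ball_vol DIM('a))" for x
  proof (cases "\<exists>y\<in>ball x 1. spikes p b y \<noteq> 0")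
    case False
    then have "local_mass p (spikes p b) x = (\<integral>\<^sup>+y. 0 \<partial>(lebesgue :: 'a measure))"
      unfolding local_mass_def by (intro nn_integral_cong) (auto simp: indicator_def)
    then show ?thesis by simp
  next
    case True
    then obtain z where z: "z \<in> ball x 1" "spikes p b z \<noteq> 0" by blast
    define n where "n = spike_index b z"
    have zn: "z \<in> spike p b n" using z(2) by (auto simp: spikes_def n_def split: if_splits)
    have only: "y \<in> spike p b n" if y: "y \<in> ball x 1" "spikes p b y \<noteq> 0" for y
    proof -
      define m where "m = spike_index b y"
      have ym: "y \<in> spike p b m" using y(2) by (auto simp: spikes_def m_def split: if_splits)
      have "\<bar>(y - z) \<bullet> b\<bar> \<le> norm (y - z)"
        using Basis_le_norm[OF assms(2)] .
      also have "\<dots> < 2"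
        using y(1) z(1) dist_triangle_less_add[of y x 1 z 1] by (simp add: dist_norm norm_minus_commute)
      \<comment> \<open>Along \<open>b\<close>, each point is within 1 of its spike centre and the
        two points are within 2 of each other. Centres differ by multiples of 4, so the indices
        agree.\<close>
      finally have "\<bar>4 * real m - 4 * real n\<bar> < 4"
        using spike_inner[OF assms ym] spike_inner[OF assms zn] by (simp add: inner_diff_left)
      then have "m = n" by linarith
      with ym show ?thesis by simp
    qed
    have "local_mass p (spikes p b) x \<le> (\<integral>\<^sup>+y. ennreal ((real n + 1) powr p) * indicator (spike p b n) y \<partial>lebesgue)"
      unfolding local_mass_def
    proof (rule nn_integral_mono)
      fix y
      show "ennreal (\<bar>spikes p b y\<bar> powr p) * indicator (ball x 1) y \<le>
          ennreal ((real n + 1) powr p) * indicator (spike p b n) y"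
        using only[of y] spikes_eq[OF assms, of y n]
        by (cases "y \<in> ball x 1 \<and> spikes p b y \<noteq> 0") auto
    qed
    also have "\<dots> = ennreal ((1 * (real n + 1)) powr p) * emeasure lebesgue (spike p b n)"
      by (subst nn_integral_cmult_indicator) (auto simp: spike_def)
    also have "\<dots> = ennreal (unit_ball_vol DIM('a))"
      by (subst spike_mass) auto
    finally show ?thesis by simp
  qed
qed fact

text \<open>Every truncation level cuts away at least half the height of all sufficiently high
  spikes, which leaves an error mass of at least \<open>c\<close> near their centres.\<close>

lemma spikes_not_bounded_approximable:
  fixes b :: "'a::euclidean_space"
  assumes "p > 0" "b \<in> Basis"
  shows "\<not> bounded_approximable p (spikes p b)"
proof
  assume "bounded_approximable p (spikes p b)"
  define c where "c = (1 / 2) powr p * unit_ball_vol DIM('a)"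
  have "c > 0" by (simp add: c_def)
  then have "\<exists>M\<ge>0. \<forall>x. local_mass p (\<lambda>y. truncate M (spikes p b) y - spikes p b y) x \<le> ennreal (c / 2)"
    using \<open>bounded_approximable p (spikes p b)\<close> spikes_in_LU[OF assms]
    by (simp add: bounded_approximable_iff_truncate truncate_tendsto_iff \<open>p > 0\<close>)
  then obtain M where M: "M \<ge> 0"
    "\<And>x. local_mass p (\<lambda>y. truncate M (spikes p b) y - spikes p b y) x \<le> ennreal (c / 2)"
    by blast
  \<comment> \<open>With \<open>M \<le> n / 2\<close> the error on the spike is
    \<open>n + 1 - M\<close>, at least half of \<open>n + 1\<close>.\<close>
  obtain n where n: "2 * M \<le> real n" using real_arch_simple by blast
  have "ennreal c = ennreal ((1 / 2 * (real n + 1)) powr p) * emeasure lebesgue (spike p b n)"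
    unfolding c_def by (rule spike_mass[symmetric]) simp
  also have "\<dots> = (\<integral>\<^sup>+y. ennreal ((1 / 2 * (real n + 1)) powr p) * indicator (spike p b n) y \<partial>lebesgue)"
    by (subst nn_integral_cmult_indicator) (auto simp: spike_def)
  also have "\<dots> \<le> local_mass p (\<lambda>y. truncate M (spikes p b) y - spikes p b y) ((4 * real n) *\<^sub>R b)"
    unfolding local_mass_def
  proof (rule nn_integral_mono)
    fix y
    show "ennreal ((1 / 2 * (real n + 1)) powr p) * indicator (spike p b n) y \<le>
      ennreal (\<bar>truncate M (spikes p b) y - spikes p b y\<bar> powr p) * indicator (ball ((4 * real n) *\<^sub>R b) 1) y"
    proof (cases "y \<in> spike p b n")
      case True
      then have "1 / 2 * (real n + 1) \<le> \<bar>truncate M (spikes p b) y - spikes p b y\<bar>"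
        using spikes_eq[OF assms True] n M(1) by (simp add: truncate_def)
      then have "(1 / 2 * (real n + 1)) powr p \<le> \<bar>truncate M (spikes p b) y - spikes p b y\<bar> powr p"
        using \<open>p > 0\<close> by (intro powr_mono2) auto
      moreover have "y \<in> ball ((4 * real n) *\<^sub>R b) 1"
        using spike_subset_ball[OF \<open>p > 0\<close>] True by blast
      ultimately show ?thesis
        using True by (simp add: ennreal_leI)
    qed simp
  qed
  also have "\<dots> \<le> ennreal (c / 2)" by (rule M(2))
  finally show False
    using \<open>c > 0\<close> by (simp add: ennreal_le_iff)
qed

lemma bounded_approximable_psubset_LU:
  assumes "p > 0"
  shows "{V :: 'a::euclidean_space \<Rightarrow> real. V \<in> LU p \<and> bounded_approximable p V} \<subset> LU p"
proof -
  obtain b :: 'a where "b \<in> Basis" using nonempty_Basis by blast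
  with assms spikes_in_LU spikes_not_bounded_approximable show ?thesis by blast
qed

theorem proposition3p5:
  fixes p\<^sub>0 :: real
  assumes "1 \<le> p\<^sub>0"
  shows
    "(\<forall>V :: real ^ 'n \<Rightarrow> real. V \<in> LU p\<^sub>0 \<longrightarrow>
        (bounded_approximable p\<^sub>0 V \<longleftrightarrow>
           ((\<lambda>M. LU_norm p\<^sub>0 (\<lambda>x. truncate M V x - V x)) \<longlongrightarrow> 0) at_top)) \<and>
     (\<forall>V :: real ^ 'n \<Rightarrow> real. V \<in> LU_dot p\<^sub>0 \<longrightarrow> bounded_approximable p\<^sub>0 V) \<and>
     (\<forall>V :: real ^ 'n \<Rightarrow> real. V \<in> LU p\<^sub>0 \<longrightarrow>
        (\<exists>M\<^sub>0>0. ((\<lambda>x. LINT y:ball x 1|lebesgue. \<bar>V y - truncate M\<^sub>0 V y\<bar> powr p\<^sub>0) \<longlongrightarrow> 0)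
                   at_infinity) \<longrightarrow>
        ((\<lambda>M. LU_norm p\<^sub>0 (\<lambda>x. truncate M V x - V x)) \<longlongrightarrow> 0) at_top) \<and>
     (let \<A> = {V :: real ^ 'n \<Rightarrow> real. V \<in> LU p\<^sub>0 \<and> bounded_approximable p\<^sub>0 V} in
        fun_subspace (LU p\<^sub>0 :: (real ^ 'n \<Rightarrow> real) set) \<and> fun_subspace \<A> \<and>
        closedin (LU_topology p\<^sub>0) \<A> \<and> \<A> \<subset> LU p\<^sub>0)"
proof -
  have p: "p\<^sub>0 > 0" using assms by simp
  show ?thesis
    unfolding Let_def
    by (intro conjI allI impI)
       (auto simp: p bounded_approximable_iff_truncate fun_subspace_LU fun_subspace_bounded_approximable
          closedin_bounded_approximable bounded_approximable_psubset_LU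
          intro: LU_dot_bounded_approximable truncate_tendsto_of_tail)
qed

end
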